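(* Let $T$ be a geodesic tetrahedron in $\mathbb{S}^3$, $\mathbb{R}^3$ or $\mathbb{H}^3$ with edge lengths $l_{ij}$ and dihedral angles $\alpha_{ij}$. Then $$\left[e^{i\Omega_{123}},e^{i\Omega_{124}},e^{i\Omega_{134}},e^{i\Omega_{234}}\right]=\begin{cases}\left[e^{i\Pi_{123}},e^{i\Pi_{124}},e^{i\Pi_{134}},e^{i\Pi_{234}}\right] & \text{if } T \text{ is spherical},\\ \left[\Pi_{123},\Pi_{124},\Pi_{134},\Pi_{234}\right] & \text{if } T \text{ is Euclidean},\\ \left[e^{\Pi_{123}},e^{\Pi_{124}},e^{\Pi_{134}},e^{\Pi_{234}}\right] & \text{if } T \text{ is hyperbolic},\end{cases}$$ whenever these cross-ratios are defined, i.e. when the four points involved are distinct.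
   Context: $T$ has vertices $A_1,\dots,A_4$; $l_{ij}=l_{ji}\in\mathbb{R}$ is the length of the edge $A_iA_j$, and $\alpha_{ij}=\alpha_{ji}\in\mathbb{R}/2\pi\mathbb{Z}$ is the dihedral angle at the edge $A_iA_j$. $T$ is spherical, Euclidean or hyperbolic if it lies in $\mathbb{S}^3$, $\mathbb{R}^3$ or $\mathbb{H}^3$ respectively. The perimeters of faces and the solid angles are \begin{align*} &\Pi_{123}=l_{12}+l_{13}+l_{23}, && \Omega_{123}=\alpha_{14}+\alpha_{24}+\alpha_{34}-\pi,\\ &\Pi_{124}=l_{12}+l_{14}+l_{24}, && \Omega_{124}=\alpha_{13}+\alpha_{23}+\alpha_{34}-\pi,\\ &\Pi_{134}=l_{13}+l_{14}+l_{34}, && \Omega_{134}=\alpha_{12}+\alpha_{23}+\alpha_{24}-\pi,\\ &\Pi_{234}=l_{23}+l_{24}+l_{34}, && \Omega_{234}=\alpha_{12}+\alpha_{13}+\alpha_{14}-\pi. \end{align*} For distinct $z_1,z_2,z_3,z_4\in\mathbb{C}$ the cross-ratio is $[z_1,z_2,z_3,z_4]=\dfrac{(z_1-z_2)(z_3-z_4)}{(z_1-z_4)(z_3-z_2)}$. *)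

theory Defs
  imports "HOL-Analysis.Analysis" "HOL-Library.Real_Mod"
begin

definition cross_ratio :: "complex \<Rightarrow> complex \<Rightarrow> complex \<Rightarrow> complex \<Rightarrow> complex" where
  "cross_ratio z1 z2 z3 z4 = ((z1 - z2) * (z3 - z4)) / ((z1 - z4) * (z3 - z2))"

subsection \<open>Metric data in a tangent space\<close>

text \<open>The parameter \<open>g\<close> is a symmetric bilinear form on the ambient space whose restriction to the
  tangent spaces in question is positive definite.\<close>

definition orth_part :: "('v::real_vector \<Rightarrow> 'v \<Rightarrow> real) \<Rightarrow> 'v \<Rightarrow> 'v \<Rightarrow> 'v" where
  "orth_part g u v = v - (g u v / g u u) *\<^sub>R u"

definition angle :: "('v \<Rightarrow> 'v \<Rightarrow> real) \<Rightarrow> 'v \<Rightarrow> 'v \<Rightarrow> real" where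
  "angle g u v = arccos (g u v / (sqrt (g u u) * sqrt (g v v)))"

text \<open>The angle at the edge \<open>pq\<close> between the faces \<open>pqr\<close> and \<open>pqs\<close>, measured in the tangent space
  at \<open>p\<close>, where \<open>dir p x\<close> is a positive multiple of the initial velocity of the
  geodesic from \<open>p\<close> to \<open>x\<close>.\<close>

definition dihedral_angle ::
  "('v::real_vector \<Rightarrow> 'v \<Rightarrow> real) \<Rightarrow> ('v \<Rightarrow> 'v \<Rightarrow> 'v) \<Rightarrow> 'v \<Rightarrow> 'v \<Rightarrow> 'v \<Rightarrow> 'v \<Rightarrow> real" where
  "dihedral_angle g dir p q r s =
     angle g (orth_part g (dir p q) (dir p r)) (orth_part g (dir p q) (dir p s))"

subsection \<open>The three geometries\<close>

text \<open>The space \<open>\<S>\<^sup>3\<close> is the unit sphere of \<open>\<real>\<^sup>4\<close>; \<open>\<H>\<^sup>3\<close> is the upper sheet of the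
  hyperboloid in Minkowski space \<open>\<real>\<^sup>3 \<times> \<real>\<close>, the last coordinate being timelike.\<close>

definition lorentz :: "(real^3) \<times> real \<Rightarrow> (real^3) \<times> real \<Rightarrow> real" where
  "lorentz x y = fst x \<bullet> fst y - snd x * snd y"

definition hyperboloid :: "((real^3) \<times> real) set" where
  "hyperboloid = {x. lorentz x x = -1 \<and> snd x > 0}"

definition spherical_dist :: "real^4 \<Rightarrow> real^4 \<Rightarrow> real" where
  "spherical_dist p q = arccos (p \<bullet> q)"

definition hyperbolic_dist :: "(real^3) \<times> real \<Rightarrow> (real^3) \<times> real \<Rightarrow> real" where
  "hyperbolic_dist p q = arcosh (- lorentz p q)"

definition spherical_dihedral :: "real^4 \<Rightarrow> real^4 \<Rightarrow> real^4 \<Rightarrow> real^4 \<Rightarrow> real" where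
  "spherical_dihedral = dihedral_angle (\<bullet>) (\<lambda>p x. x - (p \<bullet> x) *\<^sub>R p)"

definition euclidean_dihedral :: "real^3 \<Rightarrow> real^3 \<Rightarrow> real^3 \<Rightarrow> real^3 \<Rightarrow> real" where
  "euclidean_dihedral = dihedral_angle (\<bullet>) (\<lambda>p x. x - p)"

definition hyperbolic_dihedral ::
  "(real^3) \<times> real \<Rightarrow> (real^3) \<times> real \<Rightarrow> (real^3) \<times> real \<Rightarrow> (real^3) \<times> real \<Rightarrow> real" where
  "hyperbolic_dihedral = dihedral_angle lorentz (\<lambda>p x. x + lorentz p x *\<^sub>R p)"

subsection \<open>Tetrahedra\<close>

text \<open>A tetrahedron is given by its vertices \<open>A 1, \<dots>, A 4\<close>, which must not lie on a common totally
  geodesic surface. For \<open>\<S>\<^sup>3\<close> and \<open>\<H>\<^sup>3\<close> this is linear independence in the ambient space.\<close>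

definition spherical_tetrahedron :: "(nat \<Rightarrow> real^4) \<Rightarrow> bool" where
  "spherical_tetrahedron A \<longleftrightarrow>
     A ` {1..4} \<subseteq> sphere 0 1 \<and> inj_on A {1..4} \<and> independent (A ` {1..4})"

definition euclidean_tetrahedron :: "(nat \<Rightarrow> real^3) \<Rightarrow> bool" where
  "euclidean_tetrahedron A \<longleftrightarrow> inj_on A {1..4} \<and> \<not> affine_dependent (A ` {1..4})"

definition hyperbolic_tetrahedron :: "(nat \<Rightarrow> (real^3) \<times> real) \<Rightarrow> bool" where
  "hyperbolic_tetrahedron A \<longleftrightarrow>
     A ` {1..4} \<subseteq> hyperboloid \<and> inj_on A {1..4} \<and> independent (A ` {1..4})"

definition edge_lengths :: "('v \<Rightarrow> 'v \<Rightarrow> real) \<Rightarrow> (nat \<Rightarrow> 'v) \<Rightarrow> (nat \<Rightarrow> nat \<Rightarrow> real) \<Rightarrow> bool" where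
  "edge_lengths d A l \<longleftrightarrow> (\<forall>i\<in>{1..4}. \<forall>j\<in>{1..4}. i \<noteq> j \<longrightarrow> l i j = d (A i) (A j))"

text \<open>Dihedral angles live in \<open>\<real>/2\<pi>\<int>\<close>, so \<open>\<alpha> i j\<close> may be any real representative.\<close>

definition dihedral_angles ::
  "('v \<Rightarrow> 'v \<Rightarrow> 'v \<Rightarrow> 'v \<Rightarrow> real) \<Rightarrow> (nat \<Rightarrow> 'v) \<Rightarrow> (nat \<Rightarrow> nat \<Rightarrow> real) \<Rightarrow> bool" where
  "dihedral_angles dih A \<alpha> \<longleftrightarrow>
     (\<forall>i j k m. {i, j, k, m} = {1..4} \<longrightarrow> [\<alpha> i j = dih (A i) (A j) (A k) (A m)] (rmod 2 * pi))"

definition perimeter :: "(nat \<Rightarrow> nat \<Rightarrow> real) \<Rightarrow> nat \<Rightarrow> nat \<Rightarrow> nat \<Rightarrow> real" where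
  "perimeter l i j k = l i j + l i k + l j k"

text \<open>The solid angle \<open>\<Omega>\<^bsub>ijk\<^esub>\<close> sits at the vertex \<open>m\<close> opposite to the face \<open>ijk\<close>.\<close>

definition solid_angle :: "(nat \<Rightarrow> nat \<Rightarrow> real) \<Rightarrow> nat \<Rightarrow> nat \<Rightarrow> nat \<Rightarrow> nat \<Rightarrow> real" where
  "solid_angle \<alpha> i j k m = \<alpha> i m + \<alpha> j m + \<alpha> k m - pi"

end

theory Submission
  imports Defs
begin

text \<open>The cross-ratios depend on perimeters and solid angles only through differences over opposite
  edges. Indeed, \<open>(e\<^sup>a - e\<^sup>b) (e\<^sup>c - e\<^sup>d)\<close> is, up to a factor that is symmetric in \<open>a, b, c, d\<close>, a
  difference of two values of \<open>cosh\<close>, so the cross-ratio of \<open>e\<^sup>a, e\<^sup>b, e\<^sup>c, e\<^sup>d\<close> is a quotient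
  \<open>(C\<^sub>1\<^sub>4 - C\<^sub>1\<^sub>3) / (C\<^sub>1\<^sub>2 - C\<^sub>1\<^sub>3)\<close> built from the \<open>cosh\<close> of the three numbers
  \<open>(a \<plusminus> b \<plusminus> c \<plusminus> d) / 2\<close> with two minus signs. For perimeters, and likewise for solid angles, these
  three numbers telescope, up to sign, to the differences over the three pairs of opposite edges.
  For the cross-ratio of \<open>a, b, c, d\<close> themselves, squares take the place of \<open>cosh\<close>. Such a
  quotient is unchanged when the three \<open>C\<close> undergo a common affine map, so
  it suffices to find \<open>B\<close>, \<open>K\<close> and \<open>P > 0\<close> with
  \<open>P cos (\<alpha>\<^sub>i\<^sub>j - \<alpha>\<^sub>k\<^sub>m) = B + K L\<^sub>i\<^sub>j\<close> for all three pairs of opposite edges, where \<open>L\<^sub>i\<^sub>j\<close> is the cosine,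
  the square or the hyperbolic cosine of \<open>l\<^sub>i\<^sub>j - l\<^sub>k\<^sub>m\<close> according to the geometry. That \<open>K\<close> is nonzero
  is automatic: otherwise the three cosines would agree and the cross-ratio of the solid angles
  would vanish, although its four points are distinct.\<close>

text \<open>To find the affine relation, work in the tangent space at a vertex. If \<open>u, v, w\<close> point along the
  three edges there, projecting \<open>v\<close> and \<open>w\<close> off \<open>u\<close> shows that the dihedral angle at \<open>u\<close> has
  cosine \<open>n / (f f')\<close> and sine \<open>\<bar>u\<bar> \<surd>T / (f f')\<close>, where \<open>n\<close> is a mixed two-by-two
  Gram minor, \<open>f\<close> and \<open>f'\<close> are the square roots of the Gram determinants of the two faces, and \<open>T\<close> is
  the Gram determinant of \<open>u, v, w\<close> (lemma \<open>angle_cos_sin\<close>). All these quantities turn out to be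
  independent of the vertex used. For two opposite edges the product of the denominators involves
  each face exactly once, which gives the same number \<open>P\<close> for all pairs, and
  \<open>P cos (\<alpha>\<^sub>i\<^sub>j - \<alpha>\<^sub>k\<^sub>m) = n\<^sub>i\<^sub>j n\<^sub>k\<^sub>m + T \<bar>u\<^sub>i\<^sub>j\<bar> \<bar>u\<^sub>k\<^sub>m\<bar>\<close> (lemma \<open>cross_ratio_solid_angles\<close>).\<close>

text \<open>In the spherical and hyperbolic cases, let \<open>g\<^sub>i\<^sub>j\<close> be the entries of the Gram matrix of the four
  vertices, with diagonal \<open>\<kappa> = \<plusminus>1\<close>. Then \<open>n\<^sub>i\<^sub>j\<close> is up to sign the cofactor of this matrix at \<open>(k, m)\<close> and \<open>\<kappa> T\<close> is its
  determinant. By Jacobi's theorem on the minors of the adjugate, \<open>n\<^sub>i\<^sub>j n\<^sub>k\<^sub>m - \<kappa> T g\<^sub>i\<^sub>j g\<^sub>k\<^sub>m\<close> is the same for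
  all pairs of opposite edges (lemma \<open>curved_jacobi\<close>). What remains is \<open>T\<close> times
  \<open>\<kappa> g\<^sub>i\<^sub>j g\<^sub>k\<^sub>m + \<bar>u\<^sub>i\<^sub>j\<bar> \<bar>u\<^sub>k\<^sub>m\<bar>\<close>, and by the addition theorem for \<open>cos\<close> or \<open>cosh\<close> this is \<open>\<kappa>\<close> times the cosine
  or hyperbolic cosine of \<open>l\<^sub>i\<^sub>j - l\<^sub>k\<^sub>m\<close>. In the Euclidean case the quantity
  \<open>n\<^sub>i\<^sub>j n\<^sub>k\<^sub>m + T (l\<^sub>i\<^sub>j\<^sup>2 + l\<^sub>k\<^sub>m\<^sup>2) / 2\<close> plays the part of Jacobi's identity (lemma
  \<open>euclidean_gram_identity\<close>), and \<open>- T (l\<^sub>i\<^sub>j - l\<^sub>k\<^sub>m)\<^sup>2 / 2\<close> remains.\<close>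

section \<open>Cross-ratios as quotients of differences\<close>

lemma cross_ratio_nonzero: "distinct [a, b, c, d] \<Longrightarrow> cross_ratio a b c d \<noteq> 0"
  by (auto simp: cross_ratio_def)

text \<open>Factoring \<open>exp ((a + b + c + d) / 2)\<close> out of \<open>(exp a - exp b) * (exp c - exp d)\<close> leaves a difference
  of two hyperbolic cosines. The factor is symmetric in all four variables, so it cancels between
  numerator and denominator.\<close>

lemma cross_ratio_exp:
  fixes a b c d :: complex
  shows "cross_ratio (exp a) (exp b) (exp c) (exp d) =
    (cosh ((a - b - c + d) / 2) - cosh ((a - b + c - d) / 2)) /
    (cosh ((a + b - c - d) / 2) - cosh ((a - b + c - d) / 2))"
proof -
  have factor: "(exp a - exp b) * (exp c - exp d) =
      - 2 * exp ((a + b + c + d) / 2) * (cosh ((a - b - c + d) / 2) - cosh ((a - b + c - d) / 2))"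
    for a b c d :: complex
    unfolding cosh_field_def
    by (simp add: algebra_simps diff_divide_distrib add_divide_distrib flip: exp_add)
  have "cross_ratio (exp a) (exp b) (exp c) (exp d) =
      (- 2 * exp ((a + b + c + d) / 2) * (cosh ((a - b - c + d) / 2) - cosh ((a - b + c - d) / 2))) /
      (- 2 * exp ((a + d + c + b) / 2) * (cosh ((a - d - c + b) / 2) - cosh ((a - d + c - b) / 2)))"
    unfolding cross_ratio_def by (simp only: factor)
  also have "a + d + c + b = a + b + c + d" by simp
  also have "a - d - c + b = a + b - c - d" by simp
  also have "a - d + c - b = a - b + c - d" by simp
  finally show ?thesis
    by simp
qed

lemma cross_ratio_exp_i:
  fixes a b c d :: real
  shows "cross_ratio (exp (\<i> * a)) (exp (\<i> * b)) (exp (\<i> * c)) (exp (\<i> * d)) =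
    of_real ((cos ((a - b - c + d) / 2) - cos ((a - b + c - d) / 2)) /
    (cos ((a + b - c - d) / 2) - cos ((a - b + c - d) / 2)))"
proof -
  have pull_i: "(\<i> * a - \<i> * b - \<i> * c + \<i> * d) / 2 = \<i> * of_real ((a - b - c + d) / 2)"
    "(\<i> * a - \<i> * b + \<i> * c - \<i> * d) / 2 = \<i> * of_real ((a - b + c - d) / 2)"
    "(\<i> * a + \<i> * b - \<i> * c - \<i> * d) / 2 = \<i> * of_real ((a + b - c - d) / 2)"
    by (simp_all add: algebra_simps)
  have cosh_i: "cosh (\<i> * of_real x) = of_real (cos x)" for x
    by (simp add: cosh_conv_cos flip: cos_of_real)
  show ?thesis
    unfolding cross_ratio_exp pull_i cosh_i by simp
qed

lemma cross_ratio_exp_real: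
  fixes a b c d :: real
  shows "cross_ratio (of_real (exp a)) (of_real (exp b)) (of_real (exp c)) (of_real (exp d)) =
    of_real ((cosh ((a - b - c + d) / 2) - cosh ((a - b + c - d) / 2)) /
    (cosh ((a + b - c - d) / 2) - cosh ((a - b + c - d) / 2)))"
proof -
  have "cosh (complex_of_real x) = of_real (cosh x)" for x
    by (simp add: cosh_field_def flip: exp_of_real)
  from this[of "(a - b - c + d) / 2"] this[of "(a - b + c - d) / 2"] this[of "(a + b - c - d) / 2"]
  show ?thesis
    using cross_ratio_exp[of a b c d] by (simp add: exp_of_real)
qed

text \<open>The limit of the preceding formula when all arguments are scaled down to \<open>0\<close>: of each \<open>cosh x\<close> only the
  second-order term \<open>x\<^sup>2 / 2\<close> survives in the differences.\<close>

lemma cross_ratio_of_real: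
  fixes a b c d :: real
  shows "cross_ratio (of_real a) (of_real b) (of_real c) (of_real d) =
    of_real ((((a - b - c + d) / 2)\<^sup>2 - ((a - b + c - d) / 2)\<^sup>2) /
    (((a + b - c - d) / 2)\<^sup>2 - ((a - b + c - d) / 2)\<^sup>2))"
proof -
  have factor: "((a - b - c + d) / 2)\<^sup>2 - ((a - b + c - d) / 2)\<^sup>2 = - ((a - b) * (c - d))"
    for a b c d :: real
    by (simp add: power2_eq_square field_simps)
  have den: "((a + b - c - d) / 2)\<^sup>2 - ((a - b + c - d) / 2)\<^sup>2 = - ((a - d) * (c - b))"
    using factor[of a d c b] by (simp add: algebra_simps)
  show ?thesis
    unfolding cross_ratio_def factor den by simp
qed

section \<open>Dihedral angles through Gram determinants\<close>

text \<open>For a positive definite form on three-space this is the inner product of the cross products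
  \<open>u \<times> v\<close> and \<open>u \<times> w\<close>, the normals of two faces that meet along \<open>u\<close>.\<close>

definition gram2 :: "('v \<Rightarrow> 'v \<Rightarrow> real) \<Rightarrow> 'v \<Rightarrow> 'v \<Rightarrow> 'v \<Rightarrow> real" where
  "gram2 g u v w = g u u * g v w - g u v * g u w"

text \<open>The determinant of the Gram matrix of \<open>u, v, w\<close>.\<close>

definition gram3 :: "('v \<Rightarrow> 'v \<Rightarrow> real) \<Rightarrow> 'v \<Rightarrow> 'v \<Rightarrow> 'v \<Rightarrow> real" where
  "gram3 g u v w = g u u * (g v v * g w w - (g v w)\<^sup>2) - g u v * (g u v * g w w - g v w * g u w)
     + g u w * (g u v * g v w - g v v * g u w)"

locale symmetric_form =
  fixes g :: "'v::real_vector \<Rightarrow> 'v \<Rightarrow> real"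
  assumes bilinear: "bilinear g"
    and commute: "g x y = g y x"
begin

lemmas expand = bilinear_ladd[OF bilinear] bilinear_radd[OF bilinear]
  bilinear_lsub[OF bilinear] bilinear_rsub[OF bilinear]
  bilinear_lmul[OF bilinear] bilinear_rmul[OF bilinear]

lemma orth_part_form:
  assumes "g u u \<noteq> 0"
  shows "g (orth_part g u v) (orth_part g u w) = gram2 g u v w / g u u"
  using assms
  by (simp add: orth_part_def gram2_def expand commute[of v u] field_simps)

text \<open>The Desnanot--Jacobi identity for the Gram matrix of \<open>u, v, w\<close>. It turns the cosine of a dihedral
  angle into its sine.\<close>

lemma gram2_gram3:
  "gram2 g u v v * gram2 g u w w - (gram2 g u v w)\<^sup>2 = g u u * gram3 g u v w"
  by (simp add: gram2_def gram3_def power2_eq_square algebra_simps)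

text \<open>Definiteness on a subspace \<open>W\<close> is what the hyperboloid model provides: the Lorentz form is positive on each tangent space
  but not on the ambient space.\<close>

lemma gram2_pos:
  assumes W: "subspace W" "u \<in> W" "v \<in> W"
    and pos: "\<And>x. x \<in> W \<Longrightarrow> x \<noteq> 0 \<Longrightarrow> g x x > 0"
    and "u \<noteq> 0" "v \<notin> span {u}"
  shows "gram2 g u v v > 0"
proof -
  have u: "g u u > 0"
    using pos assms by blast
  have "orth_part g u v \<in> W"
    unfolding orth_part_def using W by (intro subspace_diff subspace_scale)
  moreover have "orth_part g u v \<noteq> 0"
    using \<open>v \<notin> span {u}\<close> by (auto simp: orth_part_def span_singleton)
  ultimately have "gram2 g u v v / g u u > 0"
    using pos orth_part_form[of u v v] u by fastforce
  then show ?thesis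
    using u by (simp add: zero_less_divide_iff)
qed

text \<open>Gram--Schmidt: up to the positive factor \<open>g u u\<close>, this determinant is the two-by-two Gram
  determinant of the components of \<open>v\<close> and \<open>w\<close> orthogonal to \<open>u\<close>, and that one is nonnegative
  because a further orthogonal projection has nonnegative square length.\<close>

lemma gram3_nonneg:
  assumes W: "subspace W" "u \<in> W" "v \<in> W" "w \<in> W"
    and pos: "\<And>x. x \<in> W \<Longrightarrow> x \<noteq> 0 \<Longrightarrow> g x x > 0"
    and "u \<noteq> 0" "v \<notin> span {u}"
  shows "gram3 g u v w \<ge> 0"
proof -
  have u: "g u u > 0"
    using pos assms by blast
  define a b where "a = orth_part g u v" and "b = orth_part g u w"
  have ab: "a \<in> W" "b \<in> W"
    unfolding a_def b_def orth_part_def using W by (auto intro!: subspace_diff subspace_scale)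
  have aa: "g a a > 0"
    using gram2_pos[OF W(1-3) pos \<open>u \<noteq> 0\<close> \<open>v \<notin> span {u}\<close>] u orth_part_form[of u v v]
    by (simp add: a_def)
  have "orth_part g a b \<in> W"
    unfolding orth_part_def using W ab by (intro subspace_diff subspace_scale)
  then have "g (orth_part g a b) (orth_part g a b) \<ge> 0"
    using pos[of "orth_part g a b"] bilinear_lzero[OF bilinear, of 0]
    by (cases "orth_part g a b = 0") (auto simp: less_imp_le)
  then have "gram2 g a b b \<ge> 0"
    using aa orth_part_form[of a b b] by (simp add: zero_le_divide_iff)
  moreover have "gram2 g a b b = gram3 g u v w / g u u"
  proof -
    have "gram2 g a b b = g a a * g b b - g a b * g a b"
      by (simp add: gram2_def)
    also have "\<dots> = (gram2 g u v v * gram2 g u w w - (gram2 g u v w)\<^sup>2) / (g u u)\<^sup>2"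
      unfolding a_def b_def
      using u by (simp add: orth_part_form power2_eq_square diff_divide_distrib)
    finally show ?thesis
      using u unfolding gram2_gram3 by (simp add: power2_eq_square)
  qed
  ultimately show ?thesis
    using u by (simp add: zero_le_divide_iff)
qed

text \<open>The common factor \<open>1 / g u u\<close> of all products of orthogonal parts cancels in the cosine. Since
  \<open>arccos\<close> takes values with nonnegative sine, the sine is the positive root of \<open>1 - cos\<^sup>2\<close>, evaluated
  with \<open>gram2_gram3\<close>. The same identity provides the bound on the cosine under which \<open>arccos\<close>
  is an inverse.\<close>

lemma angle_cos_sin:
  assumes W: "subspace W" "u \<in> W" "v \<in> W" "w \<in> W"
    and pos: "\<And>x. x \<in> W \<Longrightarrow> x \<noteq> 0 \<Longrightarrow> g x x > 0"
    and "u \<noteq> 0" "v \<notin> span {u}" "w \<notin> span {u}"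
  defines "\<theta> \<equiv> angle g (orth_part g u v) (orth_part g u w)"
    and "N \<equiv> sqrt (gram2 g u v v) * sqrt (gram2 g u w w)"
  shows "cos \<theta> = gram2 g u v w / N"
    and "sin \<theta> = sqrt (g u u) * sqrt (gram3 g u v w) / N"
proof -
  have u: "g u u > 0"
    using pos assms by blast
  have v: "gram2 g u v v > 0" and w: "gram2 g u w w > 0"
    using gram2_pos[of W u] assms by blast+
  have T: "gram3 g u v w \<ge> 0"
    using gram3_nonneg[of W u v w] assms by blast
  have N: "N > 0" "N\<^sup>2 = gram2 g u v v * gram2 g u w w"
    using v w by (auto simp: N_def power_mult_distrib)
  define c where "c = gram2 g u v w / N"
  have \<theta>: "\<theta> = arccos c"
    using u v w by (simp add: \<theta>_def angle_def c_def N_def orth_part_form real_sqrt_divide)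
  have "N\<^sup>2 - (gram2 g u v w)\<^sup>2 = g u u * gram3 g u v w"
    using gram2_gram3[of u v w] N(2) by simp
  then have sq: "1 - c\<^sup>2 = (g u u * gram3 g u v w) / N\<^sup>2"
    using N(1) by (simp add: c_def power_divide diff_divide_distrib flip: \<open>N\<^sup>2 - (gram2 g u v w)\<^sup>2 = _\<close>)
  also have "\<dots> \<ge> 0"
    using u T by simp
  finally have "\<bar>c\<bar> \<le> 1"
    by (simp add: abs_square_le_1)
  then have c: "-1 \<le> c" "c \<le> 1" by auto
  show "cos \<theta> = gram2 g u v w / N"
    using c by (simp add: \<theta> flip: c_def)
  show "sin \<theta> = sqrt (g u u) * sqrt (gram3 g u v w) / N"
    using c N(1) by (simp add: \<theta> sin_arccos sq real_sqrt_divide real_sqrt_mult)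
qed

lemma gram2_commute: "gram2 g u v w = gram2 g u w v"
  by (simp add: gram2_def commute)

lemma gram2_symmetric: "gram2 g u v v = gram2 g v u u"
  by (simp add: gram2_def commute)

lemma gram3_permute: "gram3 g u v w = gram3 g v u w" "gram3 g u v w = gram3 g u w v"
  by (simp_all add: gram3_def commute[of v u] commute[of w u] commute[of w v]
      power2_eq_square algebra_simps)

end

section \<open>Solid angles of a tetrahedron\<close>

abbreviation solid_angles_distinct :: "(nat \<Rightarrow> nat \<Rightarrow> real) \<Rightarrow> bool" where
  "solid_angles_distinct \<alpha> \<equiv> distinct [exp (\<i> * complex_of_real (solid_angle \<alpha> 1 2 3 4)),
      exp (\<i> * complex_of_real (solid_angle \<alpha> 1 2 4 3)),
      exp (\<i> * complex_of_real (solid_angle \<alpha> 1 3 4 2)),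
      exp (\<i> * complex_of_real (solid_angle \<alpha> 2 3 4 1))]"

abbreviation solid_angle_cross_ratio :: "(nat \<Rightarrow> nat \<Rightarrow> real) \<Rightarrow> complex" where
  "solid_angle_cross_ratio \<alpha> \<equiv> cross_ratio (exp (\<i> * complex_of_real (solid_angle \<alpha> 1 2 3 4)))
      (exp (\<i> * complex_of_real (solid_angle \<alpha> 1 2 4 3)))
      (exp (\<i> * complex_of_real (solid_angle \<alpha> 1 3 4 2)))
      (exp (\<i> * complex_of_real (solid_angle \<alpha> 2 3 4 1)))"

context symmetric_form
begin

text \<open>The part of the argument that is common to the three geometries. Here \<open>e i j\<close> is the direction at
  the vertex \<open>A i\<close> of the edge to \<open>A j\<close>, and \<open>W i\<close> is the tangent space there. The symmetry assumptions say that
  the Gram quantities of an edge, a face or the whole tetrahedron do not depend on the vertex at which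
  they are measured. Given them, the product of cosines and the product of sines over opposite
  edges have the same denominator \<open>P\<close>, in which every face occurs once, so the assumed affine
  relation becomes one between the \<open>cos (\<alpha> i j - \<alpha> k m)\<close> and the \<open>L\<close>.\<close>

lemma cross_ratio_solid_angles:
  fixes A :: "nat \<Rightarrow> 'v" and dir :: "'v \<Rightarrow> 'v \<Rightarrow> 'v" and W :: "nat \<Rightarrow> 'v set"
    and \<alpha> :: "nat \<Rightarrow> nat \<Rightarrow> real"
  assumes e_def: "e = (\<lambda>i j. dir (A i) (A j))"
    and n_def: "n = (\<lambda>i j k m. gram2 g (e i j) (e i k) (e i m))"
    and S_def: "S = (\<lambda>i j. sqrt (g (e i j) (e i j)))"
    and T_def: "T = gram3 g (e 1 2) (e 1 3) (e 1 4)"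
    and W: "\<And>i. i \<in> {1..4} \<Longrightarrow> subspace (W i)"
    "\<And>i j. i \<in> {1..4} \<Longrightarrow> j \<in> {1..4} \<Longrightarrow> e i j \<in> W i"
    and pos: "\<And>i x. i \<in> {1..4} \<Longrightarrow> x \<in> W i \<Longrightarrow> x \<noteq> 0 \<Longrightarrow> g x x > 0"
    and nondeg: "\<And>i j k. {i, j, k} \<subseteq> {1..4} \<Longrightarrow> distinct [i, j, k] \<Longrightarrow> e i k \<notin> span {e i j}"
    and S_swap: "\<And>i j. {i, j} \<subseteq> {1..4} \<Longrightarrow> S i j = S j i"
    and n_swap: "\<And>i j k m. {i, j, k, m} \<subseteq> {1..4} \<Longrightarrow> n i j k m = n j i k m"
    and gram3_swap: "\<And>i j k m. {i, j, k, m} \<subseteq> {1..4} \<Longrightarrow>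
      gram3 g (e i j) (e i k) (e i m) = gram3 g (e j i) (e j k) (e j m)"
    and affine: "n 1 2 3 4 * n 3 4 1 2 + T * (S 1 2 * S 3 4) = B + K * L12"
      "n 1 3 2 4 * n 2 4 1 3 + T * (S 1 3 * S 2 4) = B + K * L13"
      "n 1 4 2 3 * n 2 3 1 4 + T * (S 1 4 * S 2 3) = B + K * L14"
    and \<alpha>: "dihedral_angles (dihedral_angle g dir) A \<alpha>"
    and dist: "solid_angles_distinct \<alpha>"
  shows "solid_angle_cross_ratio \<alpha> =
    of_real ((L14 - L13) / (L12 - L13))" (is "?lhs = _")
proof -
  have I: "{1..4} = {1, 2, 3, 4::nat}" by auto
  define F where "F = (\<lambda>i j k. n i j k k)"
  have F_swap: "F i j k = F j i k" "F i j k = F i k j" if "{i, j, k} \<subseteq> {1..4}" for i j k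
    using n_swap[of i j k k] that by (auto simp: F_def n_def gram2_symmetric)
  have F_pos: "F i j k > 0" if "{i, j, k} \<subseteq> {1..4}" "distinct [i, j, k]" for i j k
  proof -
    have "e i j \<noteq> 0"
      using nondeg[of i k j] that by (auto simp: span_zero insert_commute)
    then show ?thesis
      unfolding F_def n_def using that W pos nondeg[of i j k]
      by (intro gram2_pos[of "W i"]) auto
  qed
  have T_eq: "gram3 g (e i j) (e i k) (e i m) = T" if "{i, j, k, m} = {1..4}" "distinct [i, j, k, m]"
    for i j k m
  proof -
    define G where "G = (\<lambda>i j k m. gram3 g (e i j) (e i k) (e i m))"
    have perm: "G i j k m = G i k j m" "G i j k m = G i j m k" for i j k m
      by (auto simp: G_def intro: gram3_permute)
    have swap: "G i j k m = G j i k m" if "{i, j, k, m} \<subseteq> {1..4}" for i j k m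
      using gram3_swap[OF that] by (simp add: G_def)
    have base: "G 2 1 3 4 = T" "G 3 1 2 4 = T" "G 4 1 2 3 = T" "G 1 2 3 4 = T"
      using swap[of 2 1 3 4] swap[of 3 1 2 4] swap[of 4 1 2 3] perm(1)[of 1 3 2 4]
        perm(1)[of 1 4 2 3] perm(2)[of 1 2 4 3] by (auto simp: I T_def G_def)
    \<comment> \<open>Together with \<open>base\<close> this covers all 24 orderings of the vertices.\<close>
    have perms: "G i a b c = T \<and> G i a c b = T \<and> G i b a c = T \<and> G i b c a = T \<and> G i c a b = T \<and> G i c b a = T"
      if "G i a b c = T" for i a b c
      using that perm by metis
    have "i \<in> {1..4}" "j \<in> {1..4}" "k \<in> {1..4}" "m \<in> {1..4}"
      using that(1) by blast+
    then have "i = 1 \<or> i = 2 \<or> i = 3 \<or> i = 4" "j = 1 \<or> j = 2 \<or> j = 3 \<or> j = 4"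
      "k = 1 \<or> k = 2 \<or> k = 3 \<or> k = 4" "m = 1 \<or> m = 2 \<or> m = 3 \<or> m = 4"
      by auto
    then have "G i j k m = T"
      using that(2) base[THEN perms] by (elim disjE) simp_all
    then show ?thesis by (simp add: G_def)
  qed
  have T_nonneg: "T \<ge> 0"
  proof -
    have "e 1 2 \<noteq> 0"
      using nondeg[of 1 3 2] by (auto simp: span_zero)
    then show ?thesis
      unfolding T_def using W nondeg[of 1 2 3]
      by (intro gram3_nonneg[of "W 1"]) (auto intro: pos[of 1])
  qed
  have cos_sin: "cos (\<alpha> i j) = n i j k m / (sqrt (F i j k) * sqrt (F i j m))"
      "sin (\<alpha> i j) = S i j * sqrt T / (sqrt (F i j k) * sqrt (F i j m))"
    if ijkm: "{i, j, k, m} = {1..4}" "distinct [i, j, k, m]" for i j k m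
  proof -
    have mem: "i \<in> {1..4}" "j \<in> {1..4}" "k \<in> {1..4}" "m \<in> {1..4}"
      using ijkm(1) by blast+
    have "e i j \<noteq> 0"
      using nondeg[of i k j] mem ijkm(2) by (auto simp: span_zero)
    moreover have "e i k \<notin> span {e i j}" "e i m \<notin> span {e i j}"
      using nondeg[of i j k] nondeg[of i j m] mem ijkm(2) by auto
    moreover have \<theta>: "[\<alpha> i j = angle g (orth_part g (e i j) (e i k)) (orth_part g (e i j) (e i m))] (rmod 2 * pi)"
      using \<alpha>[unfolded dihedral_angles_def, rule_format, OF ijkm(1)]
      by (simp add: dihedral_angle_def e_def)
    ultimately show "cos (\<alpha> i j) = n i j k m / (sqrt (F i j k) * sqrt (F i j m))"
      "sin (\<alpha> i j) = S i j * sqrt T / (sqrt (F i j k) * sqrt (F i j m))"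
      using angle_cos_sin[of "W i" "e i j" "e i k" "e i m", OF _ _ _ _ pos] W mem
        cos_rcong[OF \<theta>] sin_rcong[OF \<theta>] T_eq[OF ijkm]
      by (simp_all add: n_def S_def F_def)
  qed
  have cis_swap: "cis (\<alpha> i j) = cis (\<alpha> j i)" if "{i, j, k, m} = {1..4}" "distinct [i, j, k, m]" for i j k m
  proof -
    have "{j, i, k, m} = {1..4}" "distinct [j, i, k, m]"
      using that by (simp_all add: insert_commute)
    note swapped = cos_sin[OF this]
    have "i \<in> {1..4}" "j \<in> {1..4}" "k \<in> {1..4}" "m \<in> {1..4}"
      using that(1) by blast+
    then have "F j i k = F i j k" "F j i m = F i j m" "n j i k m = n i j k m" "S j i = S i j"
      using F_swap(1)[of j i k] F_swap(1)[of j i m] n_swap[of j i k m] S_swap[of j i]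
      by simp_all
    then show ?thesis
      using cos_sin[OF that] swapped by (simp add: complex_eq_iff)
  qed
  \<comment> \<open>Each of the four faces occurs once, so \<open>P\<close> is the same for all pairs of opposite edges.\<close>
  define P where "P = sqrt (F 1 2 3) * sqrt (F 1 2 4) * sqrt (F 1 3 4) * sqrt (F 2 3 4)"
  have P: "P > 0"
    unfolding P_def using F_pos by (intro mult_pos_pos) auto
  have opposite: "P * cos (\<alpha> i j - \<alpha> k m) = n i j k m * n k m i j + T * (S i j * S k m)"
    if "{i, j, k, m} = {1..4}" "distinct [i, j, k, m]"
      and P': "P = sqrt (F i j k) * sqrt (F i j m) * sqrt (F i k m) * sqrt (F j k m)" for i j k m
  proof -
    have kmij: "{k, m, i, j} = {1..4}" "distinct [k, m, i, j]"
      using that by (simp_all add: insert_commute eq_commute)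
    have mem: "i \<in> {1..4}" "j \<in> {1..4}" "k \<in> {1..4}" "m \<in> {1..4}"
      using that(1) by blast+
    have F: "F k m i = F i k m" "F k m j = F j k m"
      using mem F_swap(2)[of k m i] F_swap(1)[of k i m] F_swap(2)[of k m j] F_swap(1)[of k j m]
      by simp_all
    have PP: "P = (sqrt (F i j k) * sqrt (F i j m)) * (sqrt (F k m i) * sqrt (F k m j))"
      by (simp add: P' F)
    have "cos (\<alpha> i j - \<alpha> k m) = cos (\<alpha> i j) * cos (\<alpha> k m) + sin (\<alpha> i j) * sin (\<alpha> k m)"
      by (rule cos_diff)
    also have "\<dots> = n i j k m * n k m i j / P + S i j * sqrt T * (S k m * sqrt T) / P"
      unfolding cos_sin[OF that(1,2)] cos_sin[OF kmij] PP by simp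
    also have "S i j * sqrt T * (S k m * sqrt T) = T * (S i j * S k m)"
      using T_nonneg by (simp add: ac_simps)
    finally show ?thesis
      using P by (simp add: field_simps)
  qed
  define C12 C13 C14 where "C12 = cos (\<alpha> 1 2 - \<alpha> 3 4)" and "C13 = cos (\<alpha> 1 3 - \<alpha> 2 4)"
    and "C14 = cos (\<alpha> 1 4 - \<alpha> 2 3)"
  have PC: "P * C12 = B + K * L12" "P * C13 = B + K * L13" "P * C14 = B + K * L14"
  proof -
    have F: "F 1 3 2 = F 1 2 3" "F 3 2 4 = F 2 3 4" "F 1 4 2 = F 1 2 4" "F 1 4 3 = F 1 3 4"
      "F 4 2 3 = F 2 3 4"
      using F_swap(2)[of 1 3 2] F_swap(1)[of 3 2 4] F_swap(2)[of 1 4 2] F_swap(2)[of 1 4 3]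
        F_swap(1)[of 4 2 3] F_swap(2)[of 2 4 3] by simp_all
    show "P * C12 = B + K * L12"
      using opposite[of 1 2 3 4] affine(1)
      by (simp add: I P_def C12_def insert_commute del: One_nat_def)
    show "P * C13 = B + K * L13"
      using opposite[of 1 3 2 4] affine(2)
      by (simp add: I P_def C13_def F insert_commute del: One_nat_def)
    show "P * C14 = B + K * L14"
      using opposite[of 1 4 2 3] affine(3)
      by (simp add: I P_def C14_def F insert_commute del: One_nat_def)
  qed
  have exp_sum: "exp (\<i> * complex_of_real (x + y + z - pi)) = - (cis x * cis y * cis z)" for x y z
    unfolding cis_conv_exp[symmetric] cis_mult by (simp add: complex_eq_iff)
  \<comment> \<open>Only the exponentials of \<open>\<alpha> i j\<close> and \<open>\<alpha> j i\<close> agree, so the symmetry must be used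
     before the arguments are halved.\<close>
  have cis_ji: "cis (\<alpha> 4 3) = cis (\<alpha> 3 4)" "cis (\<alpha> 3 2) = cis (\<alpha> 2 3)" "cis (\<alpha> 4 2) = cis (\<alpha> 2 4)"
    "cis (\<alpha> 2 1) = cis (\<alpha> 1 2)" "cis (\<alpha> 3 1) = cis (\<alpha> 1 3)" "cis (\<alpha> 4 1) = cis (\<alpha> 1 4)"
    by (rule cis_swap[of _ _ 1 2] cis_swap[of _ _ 1 3] cis_swap[of _ _ 1 4] cis_swap[of _ _ 2 3]
        cis_swap[of _ _ 2 4] cis_swap[of _ _ 3 4]; auto simp: I; fail)+
  have \<Omega>: "exp (\<i> * complex_of_real (solid_angle \<alpha> 1 2 3 4)) = exp (\<i> * complex_of_real (\<alpha> 1 4 + \<alpha> 2 4 + \<alpha> 3 4 - pi))"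
    "exp (\<i> * complex_of_real (solid_angle \<alpha> 1 2 4 3)) = exp (\<i> * complex_of_real (\<alpha> 1 3 + \<alpha> 2 3 + \<alpha> 3 4 - pi))"
    "exp (\<i> * complex_of_real (solid_angle \<alpha> 1 3 4 2)) = exp (\<i> * complex_of_real (\<alpha> 1 2 + \<alpha> 2 3 + \<alpha> 2 4 - pi))"
    "exp (\<i> * complex_of_real (solid_angle \<alpha> 2 3 4 1)) = exp (\<i> * complex_of_real (\<alpha> 1 2 + \<alpha> 1 3 + \<alpha> 1 4 - pi))"
    unfolding solid_angle_def exp_sum cis_ji by (rule refl)+
  have "?lhs = of_real ((C14 - C13) / (C12 - C13))"
  proof -
    have halves:
      "(\<alpha> 1 4 + \<alpha> 2 4 + \<alpha> 3 4 - pi - (\<alpha> 1 3 + \<alpha> 2 3 + \<alpha> 3 4 - pi)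
        - (\<alpha> 1 2 + \<alpha> 2 3 + \<alpha> 2 4 - pi) + (\<alpha> 1 2 + \<alpha> 1 3 + \<alpha> 1 4 - pi)) / 2 = \<alpha> 1 4 - \<alpha> 2 3"
      "(\<alpha> 1 4 + \<alpha> 2 4 + \<alpha> 3 4 - pi - (\<alpha> 1 3 + \<alpha> 2 3 + \<alpha> 3 4 - pi)
        + (\<alpha> 1 2 + \<alpha> 2 3 + \<alpha> 2 4 - pi) - (\<alpha> 1 2 + \<alpha> 1 3 + \<alpha> 1 4 - pi)) / 2 = \<alpha> 2 4 - \<alpha> 1 3"
      "(\<alpha> 1 4 + \<alpha> 2 4 + \<alpha> 3 4 - pi + (\<alpha> 1 3 + \<alpha> 2 3 + \<alpha> 3 4 - pi)
        - (\<alpha> 1 2 + \<alpha> 2 3 + \<alpha> 2 4 - pi) - (\<alpha> 1 2 + \<alpha> 1 3 + \<alpha> 1 4 - pi)) / 2 = \<alpha> 3 4 - \<alpha> 1 2"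
      by (simp_all add: field_simps)
    have "cos (\<alpha> 2 4 - \<alpha> 1 3) = C13" "cos (\<alpha> 3 4 - \<alpha> 1 2) = C12"
      unfolding C12_def C13_def by (metis cos_minus minus_diff_eq)+
    then show ?thesis
      unfolding \<Omega> cross_ratio_exp_i halves by (simp add: C14_def)
  qed
  moreover have "?lhs \<noteq> 0"
    using dist by (rule cross_ratio_nonzero)
  ultimately have "C14 \<noteq> C13" by auto
  then have K: "K \<noteq> 0"
    using PC P by auto
  have "(C14 - C13) / (C12 - C13) = (P * C14 - P * C13) / (P * C12 - P * C13)"
    using P by (simp flip: right_diff_distrib)
  also have "\<dots> = (L14 - L13) / (L12 - L13)"
    using K by (simp add: PC flip: right_diff_distrib)
  finally show ?thesis
    using \<open>?lhs = _\<close> by simp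
qed

end

section \<open>Spherical and hyperbolic tetrahedra\<close>

context symmetric_form
begin

text \<open>Both geometries live on a level set \<open>g p p = \<kappa>\<close> with \<open>\<kappa> = \<plusminus>1\<close>, and \<open>x - (\<kappa> * g p x) *\<^sub>R p\<close> is the
  orthogonal projection of \<open>x\<close> to the tangent space at \<open>p\<close>.\<close>

lemma curved_dir:
  assumes "g p p = \<kappa>" "\<kappa> = 1 \<or> \<kappa> = -1"
  shows "g (q - (\<kappa> * g p q) *\<^sub>R p) (r - (\<kappa> * g p r) *\<^sub>R p) = g q r - \<kappa> * g p q * g p r"
  using assms by (auto simp: expand commute[of q p] algebra_simps)

text \<open>Up to the sign \<open>\<kappa>\<close>, this is the minor of the Gram matrix of \<open>p, q, r, s\<close> with rows \<open>p, q, r\<close> and columns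
  \<open>p, q, s\<close>. The right-hand side shows the symmetry in \<open>p\<close> and \<open>q\<close>.\<close>

lemma curved_gram2:
  fixes \<kappa>
  defines "d \<equiv> \<lambda>p x. x - (\<kappa> * g p x) *\<^sub>R p"
  assumes "g p p = \<kappa>" "g q q = \<kappa>" "\<kappa> = 1 \<or> \<kappa> = -1"
  shows "gram2 g (d p q) (d p r) (d p s) = \<kappa> * g r s - g p r * g p s - g q r * g q s
    - \<kappa> * g p q * (g p q * g r s - g q r * g p s - g p r * g q s)"
  using assms(2-) unfolding gram2_def d_def curved_dir[OF assms(2,4)]
  by (elim disjE) (simp_all add: algebra_simps)

text \<open>By Schur complements both sides are \<open>\<kappa>\<close> times the four-by-four Gram determinant of
  \<open>p, q, r, s\<close>.\<close>

lemma curved_gram3_swap: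
  fixes \<kappa>
  defines "d \<equiv> \<lambda>p x. x - (\<kappa> * g p x) *\<^sub>R p"
  assumes "g p p = \<kappa>" "g q q = \<kappa>" "g r r = \<kappa>" "g s s = \<kappa>" "\<kappa> = 1 \<or> \<kappa> = -1"
  shows "gram3 g (d p q) (d p r) (d p s) = gram3 g (d q p) (d q r) (d q s)"
  using assms(2-)
  unfolding gram3_def d_def curved_dir[OF assms(2,6)] curved_dir[OF assms(3,6)]
  by (elim disjE) (simp_all add: commute[of q p] power2_eq_square algebra_simps)

text \<open>With \<open>G\<close> the Gram matrix of the four points and \<open>c\<close> its cofactors, this is the instance
  \<open>c\<^sub>r\<^sub>s c\<^sub>p\<^sub>q - c\<^sub>q\<^sub>s c\<^sub>p\<^sub>r = det G (g\<^sub>p\<^sub>q g\<^sub>r\<^sub>s - g\<^sub>p\<^sub>r g\<^sub>q\<^sub>s)\<close> of Jacobi's theorem on complementary minors of the adjugate. It is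
  verified as a polynomial identity in the six off-diagonal entries of \<open>G\<close>.\<close>

lemma curved_jacobi:
  fixes \<kappa>
  defines "d \<equiv> \<lambda>p x. x - (\<kappa> * g p x) *\<^sub>R p"
  defines "n \<equiv> \<lambda>p q r s. gram2 g (d p q) (d p r) (d p s)"
  assumes "g p p = \<kappa>" "g q q = \<kappa>" "g r r = \<kappa>" "g s s = \<kappa>" "\<kappa> = 1 \<or> \<kappa> = -1"
  shows "n p q r s * n r s p q - \<kappa> * gram3 g (d p q) (d p r) (d p s) * g p q * g r s =
    n p r q s * n q s p r - \<kappa> * gram3 g (d p q) (d p r) (d p s) * g p r * g q s"
proof -
  have T: "gram3 g (d p q) (d p r) (d p s) =
      (\<kappa> - \<kappa> * g p q * g p q) * ((\<kappa> - \<kappa> * g p r * g p r) * (\<kappa> - \<kappa> * g p s * g p s) - (g r s - \<kappa> * g p r * g p s)\<^sup>2) -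
      (g q r - \<kappa> * g p q * g p r) * ((g q r - \<kappa> * g p q * g p r) * (\<kappa> - \<kappa> * g p s * g p s) - (g r s - \<kappa> * g p r * g p s) * (g q s - \<kappa> * g p q * g p s)) +
      (g q s - \<kappa> * g p q * g p s) * ((g q r - \<kappa> * g p q * g p r) * (g r s - \<kappa> * g p r * g p s) - (\<kappa> - \<kappa> * g p r * g p r) * (g q s - \<kappa> * g p q * g p s))"
    using assms(4-6) unfolding gram3_def d_def curved_dir[OF assms(3,7)] by simp
  define a b c x y z where "a = g p q" "b = g p r" "c = g p s" "x = g r s" "y = g q s" "z = g q r"
  then have v: "g p q = a" "g p r = b" "g p s = c" "g r s = x" "g q s = y" "g q r = z"
    "g q p = a" "g r p = b" "g s p = c" "g s r = x" "g s q = y" "g r q = z"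
    by (auto simp: commute)
  have "\<kappa> * \<kappa> = 1" using assms(7) by auto
  then show ?thesis
    unfolding n_def T
    unfolding d_def curved_gram2[OF assms(3,4,7)] curved_gram2[OF assms(3,5,7)]
      curved_gram2[OF assms(5,6,7)] curved_gram2[OF assms(4,6,7)]
    unfolding v power2_eq_square
    by algebra
qed

text \<open>The tangent vector from \<open>A i\<close> towards \<open>A j\<close> has length \<open>S i j\<close>, the sine or
  hyperbolic sine of the edge. By Jacobi's identity the affine relation holds with \<open>K = \<kappa> * T\<close>,
  and \<open>L\<close> is the right-hand side of the addition theorem for \<open>cos\<close> or \<open>cosh\<close>.\<close>

lemma curved_cross_ratio:
  fixes A :: "nat \<Rightarrow> 'v" and \<kappa> :: real and \<alpha> :: "nat \<Rightarrow> nat \<Rightarrow> real"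
  assumes \<kappa>: "\<kappa> = 1 \<or> \<kappa> = -1"
    and norm: "\<And>i. i \<in> {1..4} \<Longrightarrow> g (A i) (A i) = \<kappa>"
    and pos: "\<And>i x. i \<in> {1..4} \<Longrightarrow> g (A i) x = 0 \<Longrightarrow> x \<noteq> 0 \<Longrightarrow> g x x > 0"
    and indep: "inj_on A {1..4}" "independent (A ` {1..4})"
    and \<alpha>: "dihedral_angles (dihedral_angle g (\<lambda>p x. x - (\<kappa> * g p x) *\<^sub>R p)) A \<alpha>"
    and dist: "solid_angles_distinct \<alpha>"
  defines "S \<equiv> \<lambda>i j. sqrt (\<kappa> - \<kappa> * (g (A i) (A j))\<^sup>2)"
  defines "L \<equiv> \<lambda>i j k m. g (A i) (A j) * g (A k) (A m) + \<kappa> * (S i j * S k m)"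
  shows "solid_angle_cross_ratio \<alpha> =
    of_real ((L 1 4 2 3 - L 1 3 2 4) / (L 1 2 3 4 - L 1 3 2 4))"
proof -
  define d where "d = (\<lambda>p x. x - (\<kappa> * g p x) *\<^sub>R p)"
  define e where "e = (\<lambda>i j. d (A i) (A j))"
  define n where "n = (\<lambda>i j k m. gram2 g (e i j) (e i k) (e i m))"
  define T where "T = gram3 g (e 1 2) (e 1 3) (e 1 4)"
  \<comment> \<open>The case \<open>r = q\<close> of \<open>curved_dir\<close>: the square length is \<open>\<kappa> - \<kappa> * g\<^sup>2\<close>.\<close>
  have S: "sqrt (g (e i j) (e i j)) = S i j" if "{i, j} \<subseteq> {1..4}" for i j
    unfolding e_def d_def S_def using curved_dir[OF norm \<kappa>, of i "A j" "A j"] norm that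
    by (simp add: power2_eq_square)
  have tangent: "g (A i) (d (A i) x) = 0" if "i \<in> {1..4}" for i x
    using \<kappa> norm[OF that] by (auto simp: d_def expand)
  have not_span: "e i k \<notin> span {e i j}"
    if "{i, j, k} \<subseteq> {1..4}" "distinct [i, j, k]" for i j k
  proof
    assume "e i k \<in> span {e i j}"
    then obtain c where "e i k = c *\<^sub>R e i j"
      by (auto simp: span_singleton)
    then have "A k = (\<kappa> * g (A i) (A k)) *\<^sub>R A i + c *\<^sub>R (A j - (\<kappa> * g (A i) (A j)) *\<^sub>R A i)"
      by (simp add: e_def d_def algebra_simps)
    also have "\<dots> \<in> span {A i, A j}"
      by (intro span_add span_scale span_diff span_base) auto
    also have "\<dots> \<subseteq> span (A ` {1..4} - {A k})"
      using that indep(1) by (intro span_mono) (auto simp: inj_on_def)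
    finally show False
      using indep(2) that by (auto simp: dependent_def)
  qed
  have n_sym: "n i j k m = n i j m k" for i j k m
    by (simp add: n_def gram2_commute)
  have n_swap: "n i j k m = n j i k m" if "{i, j} \<subseteq> {1..4}" for i j k m
    using that norm \<kappa> curved_gram2[of "A i" \<kappa> "A j" "A k" "A m"]
      curved_gram2[of "A j" \<kappa> "A i" "A k" "A m"]
    by (simp add: n_def e_def d_def commute[of "A j" "A i"] algebra_simps)
  have jacobi: "n i j k m * n k m i j - \<kappa> * T' * g (A i) (A j) * g (A k) (A m) =
      n i k j m * n j m i k - \<kappa> * T' * g (A i) (A k) * g (A j) (A m)"
    if "{i, j, k, m} \<subseteq> {1..4}" "T' = gram3 g (e i j) (e i k) (e i m)"
    for i j k m T'
    using curved_jacobi[of "A i" \<kappa> "A j" "A k" "A m"] that norm \<kappa> by (simp add: n_def e_def d_def)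
  define B where "B = n 1 2 3 4 * n 3 4 1 2 - \<kappa> * T * g (A 1) (A 2) * g (A 3) (A 4)"
  have B13: "B = n 1 3 2 4 * n 2 4 1 3 - \<kappa> * T * g (A 1) (A 3) * g (A 2) (A 4)"
    using jacobi[of 1 2 3 4 T] by (simp add: B_def T_def)
  have B14: "B = n 1 4 2 3 * n 2 3 1 4 - \<kappa> * T * g (A 1) (A 4) * g (A 2) (A 3)"
  proof -
    have T: "T = gram3 g (e 1 3) (e 1 4) (e 1 2)"
      unfolding T_def using gram3_permute by metis
    from n_swap[of 4 2 1 3] n_swap[of 3 2 1 4] have "n 4 2 1 3 = n 2 4 1 3" "n 3 2 1 4 = n 2 3 1 4"
      by simp_all
    then show ?thesis
      using jacobi[of 1 3 4 2, OF _ T] B13 commute[of "A 4" "A 2"] commute[of "A 3" "A 2"]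
        n_sym[of 1 3 4 2] n_sym[of 1 4 3 2]
      by simp
  qed
  show ?thesis
  proof (rule cross_ratio_solid_angles[OF e_def n_def refl T_def, where W = "\<lambda>i. {x. g (A i) x = 0}"
        and B = B and K = "\<kappa> * T"])
    show "subspace {x. g (A i) x = 0}" for i
      by (auto simp: subspace_def expand bilinear_rzero[OF bilinear])
    show "n i j k m = n j i k m" if "{i, j, k, m} \<subseteq> {1..4}" for i j k m
      using that by (intro n_swap) simp
    show "gram3 g (e i j) (e i k) (e i m) = gram3 g (e j i) (e j k) (e j m)"
      if "{i, j, k, m} \<subseteq> {1..4}" for i j k m
      unfolding e_def d_def using that norm \<kappa> by (intro curved_gram3_swap) auto
    have \<kappa>2: "\<kappa> * T * (\<kappa> * x) = T * x" for x
      using \<kappa> by auto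
    show "n 1 2 3 4 * n 3 4 1 2 + T * (sqrt (g (e 1 2) (e 1 2)) *
        sqrt (g (e 3 4) (e 3 4))) = B + \<kappa> * T * L 1 2 3 4"
      by (simp add: S B_def L_def distrib_left \<kappa>2)
    show "n 1 3 2 4 * n 2 4 1 3 + T * (sqrt (g (e 1 3) (e 1 3)) *
        sqrt (g (e 2 4) (e 2 4))) = B + \<kappa> * T * L 1 3 2 4"
      by (simp add: S B13 L_def distrib_left \<kappa>2)
    show "n 1 4 2 3 * n 2 3 1 4 + T * (sqrt (g (e 1 4) (e 1 4)) *
        sqrt (g (e 2 3) (e 2 3))) = B + \<kappa> * T * L 1 4 2 3"
      by (simp add: S B14 L_def distrib_left \<kappa>2)
    show "sqrt (g (e i j) (e i j)) = sqrt (g (e j i) (e j i))"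
      if "{i, j} \<subseteq> {1..4}" for i j
      using that S[of i j] S[of j i] by (simp add: S_def commute insert_commute)
    show "e i j \<in> {x. g (A i) x = 0}" if "i \<in> {1..4}" for i j
      using tangent[OF that] by (simp add: e_def)
    show "g x x > 0" if "i \<in> {1..4}" "x \<in> {x. g (A i) x = 0}" "x \<noteq> 0" for i x
      using that by (intro pos) auto
    show "e i k \<notin> span {e i j}" if "{i, j, k} \<subseteq> {1..4}" "distinct [i, j, k]" for i j k
      using that by (rule not_span)
    show "dihedral_angles (dihedral_angle g d) A \<alpha>"
      unfolding d_def by (rule \<alpha>)
  qed (fact dist)
qed

end

section \<open>Euclidean tetrahedra\<close>

lemma symmetric_form_inner: "symmetric_form ((\<bullet>) :: 'a::real_inner \<Rightarrow> 'a \<Rightarrow> real)"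
  by unfold_locales (auto simp: bilinear_def linear_iff inner_simps inner_commute)

text \<open>For a tetrahedron with one vertex at the origin and the others at \<open>u, v, w\<close>, the two sides belong
  to two pairs of opposite edges: \<open>u\<close> and \<open>w - v\<close>, respectively \<open>v\<close> and \<open>w - u\<close>. This takes over the role of
  \<open>curved_jacobi\<close>, and is a polynomial identity in the six inner products of \<open>u, v, w\<close>.\<close>

lemma euclidean_gram_identity:
  fixes u v w :: "'a::real_inner"
  shows "gram2 (\<bullet>) u v w * gram2 (\<bullet>) (w - v) (- v) (u - v)
      + gram3 (\<bullet>) u v w * ((u \<bullet> u + (w - v) \<bullet> (w - v)) / 2) =
    gram2 (\<bullet>) v u w * gram2 (\<bullet>) (w - u) (- u) (v - u)
      + gram3 (\<bullet>) u v w * ((v \<bullet> v + (w - u) \<bullet> (w - u)) / 2)"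
proof -
  define a b c x y z where "a = u \<bullet> u" "b = v \<bullet> v" "c = w \<bullet> w" "x = v \<bullet> w" "y = u \<bullet> w" "z = u \<bullet> v"
  then have val: "u \<bullet> u = a" "v \<bullet> v = b" "w \<bullet> w = c" "v \<bullet> w = x" "u \<bullet> w = y" "u \<bullet> v = z"
    "w \<bullet> v = x" "w \<bullet> u = y" "v \<bullet> u = z"
    by (auto simp: inner_commute)
  show ?thesis
    unfolding gram2_def gram3_def inner_diff_left inner_diff_right inner_minus_left
      inner_minus_right val power2_eq_square
    by (simp add: field_simps)
qed

text \<open>Moving the base point from the origin to \<open>u\<close> replaces the edge vectors \<open>u, v, w\<close> by
  \<open>- u, v - u, w - u\<close>.\<close>

lemma euclidean_gram_swap:
  fixes u v w :: "'a::real_inner"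
  shows "gram2 (\<bullet>) u v w = gram2 (\<bullet>) (- u) (v - u) (w - u)"
    and "gram3 (\<bullet>) u v w = gram3 (\<bullet>) (- u) (v - u) (w - u)"
proof -
  define a b c x y z where "a = u \<bullet> u" "b = v \<bullet> v" "c = w \<bullet> w" "x = v \<bullet> w" "y = u \<bullet> w" "z = u \<bullet> v"
  then have val: "u \<bullet> u = a" "v \<bullet> v = b" "w \<bullet> w = c" "v \<bullet> w = x" "u \<bullet> w = y" "u \<bullet> v = z"
    "w \<bullet> v = x" "w \<bullet> u = y" "v \<bullet> u = z"
    by (auto simp: inner_commute)
  show "gram2 (\<bullet>) u v w = gram2 (\<bullet>) (- u) (v - u) (w - u)"
    "gram3 (\<bullet>) u v w = gram3 (\<bullet>) (- u) (v - u) (w - u)"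
    unfolding gram2_def gram3_def inner_diff_left inner_diff_right inner_minus_left
      inner_minus_right val power2_eq_square
    by (simp_all add: algebra_simps)
qed

text \<open>The product \<open>x * y\<close> of opposite edge lengths is \<open>(x\<^sup>2 + y\<^sup>2) / 2 - (x - y)\<^sup>2 / 2\<close>. The first term
  is absorbed into the constant by \<open>euclidean_gram_identity\<close>, and the second one makes the affine relation
  hold with \<open>K = - T / 2\<close>.\<close>

lemma euclidean_cross_ratio:
  fixes A :: "nat \<Rightarrow> 'a::real_inner" and \<alpha> :: "nat \<Rightarrow> nat \<Rightarrow> real"
  assumes indep: "inj_on A {1..4}" "\<not> affine_dependent (A ` {1..4})"
    and \<alpha>: "dihedral_angles (dihedral_angle (\<bullet>) (\<lambda>p x. x - p)) A \<alpha>"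
    and distinct: "solid_angles_distinct \<alpha>"
  defines "L \<equiv> \<lambda>i j k m. (dist (A i) (A j) - dist (A k) (A m))\<^sup>2"
  shows "solid_angle_cross_ratio \<alpha> =
    of_real ((L 1 4 2 3 - L 1 3 2 4) / (L 1 2 3 4 - L 1 3 2 4))"
proof -
  interpret symmetric_form "(\<bullet>) :: 'a \<Rightarrow> 'a \<Rightarrow> real"
    by (rule symmetric_form_inner)
  define e where "e = (\<lambda>i j. A j - A i)"
  define n where "n = (\<lambda>i j k m. gram2 (\<bullet>) (e i j) (e i k) (e i m))"
  define T where "T = gram3 (\<bullet>) (e 1 2) (e 1 3) (e 1 4)"
  have S: "sqrt (e i j \<bullet> e i j) = dist (A i) (A j)" for i j
    by (simp add: e_def dist_norm norm_minus_commute flip: norm_eq_sqrt_inner)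
  have e_diff: "e i m - e i j = e j m" "- e i j = e j i" for i j m
    by (simp_all add: e_def)
  have not_span: "e i k \<notin> span {e i j}"
    if "{i, j, k} \<subseteq> {1..4}" "distinct [i, j, k]" for i j k
  proof
    assume "e i k \<in> span {e i j}"
    then obtain c where "e i k = c *\<^sub>R e i j"
      by (auto simp: span_singleton)
    then have "A k = (1 - c) *\<^sub>R A i + c *\<^sub>R A j"
      by (simp add: e_def algebra_simps)
    also have "\<dots> \<in> affine hull {A i, A j}"
      unfolding affine_hull_2 by (intro CollectI exI[of _ "1 - c"] exI[of _ c]) simp
    also have "\<dots> \<subseteq> affine hull (A ` {1..4} - {A k})"
      using that indep(1) by (intro hull_mono) (auto simp: inj_on_def)
    finally show False
      using indep(2) that by (auto simp: affine_dependent_def)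
  qed
  have n_sym: "n i j k m = n i j m k" for i j k m
    by (simp add: n_def gram2_commute)
  have n_swap: "n i j k m = n j i k m" for i j k m
    using euclidean_gram_swap(1)[of "e i j" "e i k" "e i m"]
    by (simp add: n_def e_diff)
  have identity: "n i j k m * n k m i j + T' * (((dist (A i) (A j))\<^sup>2 + (dist (A k) (A m))\<^sup>2) / 2) =
      n i k j m * n j m i k + T' * (((dist (A i) (A k))\<^sup>2 + (dist (A j) (A m))\<^sup>2) / 2)"
    if "T' = gram3 (\<bullet>) (e i j) (e i k) (e i m)" for i j k m T'
    using euclidean_gram_identity[of "e i j" "e i k" "e i m"]
    unfolding that n_def e_diff S[symmetric] by simp
  define B where "B = n 1 2 3 4 * n 3 4 1 2 + T * (((dist (A 1) (A 2))\<^sup>2 + (dist (A 3) (A 4))\<^sup>2) / 2)"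
  have B13: "B = n 1 3 2 4 * n 2 4 1 3 + T * (((dist (A 1) (A 3))\<^sup>2 + (dist (A 2) (A 4))\<^sup>2) / 2)"
    unfolding B_def by (rule identity) (simp add: T_def)
  have B14: "B = n 1 4 2 3 * n 2 3 1 4 + T * (((dist (A 1) (A 4))\<^sup>2 + (dist (A 2) (A 3))\<^sup>2) / 2)"
  proof -
    have T: "T = gram3 (\<bullet>) (e 1 3) (e 1 4) (e 1 2)"
      unfolding T_def using gram3_permute by metis
    show ?thesis
      using identity[OF T] B13 dist_commute[of "A 4" "A 2"] dist_commute[of "A 3" "A 2"]
        n_sym[of 1 3 4 2] n_sym[of 1 4 3 2] n_swap[of 4 2 1 3] n_swap[of 3 2 1 4] by simp
  qed
  have square: "T * (x * y) = T * ((x\<^sup>2 + y\<^sup>2) / 2) + (- T / 2) * (x - y)\<^sup>2" for x y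
    by (simp add: power2_eq_square field_simps)
  show ?thesis
  proof (rule cross_ratio_solid_angles[where dir = "\<lambda>p x. x - p" and A = A,
        OF e_def n_def refl T_def, where W = "\<lambda>_. UNIV" and B = B and K = "- T / 2"])
    show "n i j k m = n j i k m" for i j k m
      by (rule n_swap)
    show "gram3 (\<bullet>) (e i j) (e i k) (e i m) = gram3 (\<bullet>) (e j i) (e j k) (e j m)" for i j k m
      using euclidean_gram_swap(2)[of "e i j" "e i k" "e i m"]
      by (simp only: e_diff)
    show "n 1 2 3 4 * n 3 4 1 2 + T * (sqrt (e 1 2 \<bullet> e 1 2) *
        sqrt (e 3 4 \<bullet> e 3 4)) = B + - T / 2 * L 1 2 3 4"
      unfolding S square L_def B_def by simp
    show "n 1 3 2 4 * n 2 4 1 3 + T * (sqrt (e 1 3 \<bullet> e 1 3) *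
        sqrt (e 2 4 \<bullet> e 2 4)) = B + - T / 2 * L 1 3 2 4"
      unfolding S square L_def B13 by simp
    show "n 1 4 2 3 * n 2 3 1 4 + T * (sqrt (e 1 4 \<bullet> e 1 4) *
        sqrt (e 2 3 \<bullet> e 2 3)) = B + - T / 2 * L 1 4 2 3"
      unfolding S square L_def B14 by simp
    show "sqrt (e i j \<bullet> e i j) = sqrt (e j i \<bullet> e j i)" for i j
      unfolding S by (rule dist_commute)
    show "e i k \<notin> span {e i j}" if "{i, j, k} \<subseteq> {1..4}" "distinct [i, j, k]" for i j k
      using that by (rule not_span)
  qed (use \<alpha> distinct in \<open>simp_all del: One_nat_def\<close>)
qed

section \<open>Edge lengths in the three geometries\<close>

lemma perimeter_combinations:
  fixes l :: "nat \<Rightarrow> nat \<Rightarrow> real"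
  shows "(perimeter l 1 2 3 - perimeter l 1 2 4 - perimeter l 1 3 4 + perimeter l 2 3 4) / 2 = l 2 3 - l 1 4"
    "(perimeter l 1 2 3 - perimeter l 1 2 4 + perimeter l 1 3 4 - perimeter l 2 3 4) / 2 = l 1 3 - l 2 4"
    "(perimeter l 1 2 3 + perimeter l 1 2 4 - perimeter l 1 3 4 - perimeter l 2 3 4) / 2 = l 1 2 - l 3 4"
  by (simp_all add: perimeter_def)

lemma spherical_law:
  fixes p q :: "'a::real_inner"
  assumes "norm p = 1" "norm q = 1"
  shows "cos (arccos (p \<bullet> q)) = p \<bullet> q" "sin (arccos (p \<bullet> q)) = sqrt (1 - (p \<bullet> q)\<^sup>2)"
proof -
  have "\<bar>p \<bullet> q\<bar> \<le> 1"
    using Cauchy_Schwarz_ineq2[of p q] assms by simp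
  then show "cos (arccos (p \<bullet> q)) = p \<bullet> q" "sin (arccos (p \<bullet> q)) = sqrt (1 - (p \<bullet> q)\<^sup>2)"
    by (auto intro: cos_arccos sin_arccos simp: abs_le_iff)
qed

lemma symmetric_form_lorentz: "symmetric_form lorentz"
  by unfold_locales
    (auto simp: bilinear_def linear_iff lorentz_def inner_simps inner_commute algebra_simps)

text \<open>A timelike vector has a spacelike orthogonal complement. In coordinates this is the
  Cauchy--Schwarz inequality for the spatial parts.\<close>

lemma lorentz_tangent_pos:
  assumes "p \<in> hyperboloid" "lorentz p x = 0" "x \<noteq> 0"
  shows "lorentz x x > 0"
proof -
  obtain a s where p: "p = (a, s)" by (cases p)
  obtain b t where x: "x = (b, t)" by (cases x)
  have s: "a \<bullet> a = s\<^sup>2 - 1" "s > 0" and ab: "a \<bullet> b = s * t"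
    using assms by (auto simp: hyperboloid_def lorentz_def p x power2_eq_square)
  have "(s * t)\<^sup>2 \<le> (s\<^sup>2 - 1) * (b \<bullet> b)"
    using Cauchy_Schwarz_ineq[of a b] by (simp add: ab s)
  then have *: "s\<^sup>2 * (b \<bullet> b - t\<^sup>2) \<ge> b \<bullet> b"
    by (simp add: power_mult_distrib algebra_simps)
  have "b \<noteq> 0"
    using ab s(2) assms(3) by (auto simp: x zero_prod_def)
  then have "b \<bullet> b > 0" by simp
  then have "s\<^sup>2 * (b \<bullet> b - t\<^sup>2) > 0"
    using * by linarith
  then have "b \<bullet> b - t\<^sup>2 > 0"
    using s(2) by (simp add: zero_less_mult_iff)
  then show ?thesis
    by (simp add: x lorentz_def power2_eq_square)
qed

text \<open>The reversed Cauchy--Schwarz inequality on the upper sheet, which puts the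
  argument of \<open>arcosh\<close> in \<open>hyperbolic_dist\<close> into the range where \<open>arcosh\<close> inverts \<open>cosh\<close>.\<close>

lemma lorentz_le_minus_one:
  assumes "p \<in> hyperboloid" "q \<in> hyperboloid"
  shows "- lorentz p q \<ge> 1"
proof -
  obtain a s where p: "p = (a, s)" by (cases p)
  obtain b t where q: "q = (b, t)" by (cases q)
  have s: "a \<bullet> a = s\<^sup>2 - 1" "s > 0" and t: "b \<bullet> b = t\<^sup>2 - 1" "t > 0"
    using assms by (auto simp: hyperboloid_def lorentz_def p q power2_eq_square)
  have "1\<^sup>2 \<le> s\<^sup>2" "1\<^sup>2 \<le> t\<^sup>2"
    using inner_ge_zero[of a] inner_ge_zero[of b] by (auto simp: s t)
  then have "1 \<le> s" "1 \<le> t"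
    using s(2) t(2) by (auto intro: power2_le_imp_le)
  then have st: "s * t \<ge> 1"
    using mult_mono[of 1 s 1 t] by simp
  have "(a \<bullet> b)\<^sup>2 \<le> (s\<^sup>2 - 1) * (t\<^sup>2 - 1)"
    using Cauchy_Schwarz_ineq[of a b] by (simp add: s t)
  also have "\<dots> = (s * t - 1)\<^sup>2 - (s - t)\<^sup>2"
    by (simp add: power2_eq_square algebra_simps)
  also have "\<dots> \<le> (s * t - 1)\<^sup>2" by simp
  finally have "a \<bullet> b \<le> s * t - 1"
    by (rule power2_le_imp_le) (use st in simp)
  then show ?thesis
    by (simp add: p q lorentz_def)
qed

lemma hyperbolic_law:
  assumes "p \<in> hyperboloid" "q \<in> hyperboloid"
  shows "cosh (hyperbolic_dist p q) = - lorentz p q"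
    "sinh (hyperbolic_dist p q) = sqrt ((lorentz p q)\<^sup>2 - 1)"
  using lorentz_le_minus_one[OF assms] by (simp_all add: hyperbolic_dist_def sinh_arcosh_real)

lemma spherical_tetrahedron_cross_ratio:
  fixes l \<alpha> :: "nat \<Rightarrow> nat \<Rightarrow> real"
  assumes A: "spherical_tetrahedron A" and l: "edge_lengths spherical_dist A l"
    and \<alpha>: "dihedral_angles spherical_dihedral A \<alpha>"
    and distinct: "solid_angles_distinct \<alpha>"
  shows "solid_angle_cross_ratio \<alpha> =
    cross_ratio (exp (\<i> * complex_of_real (perimeter l 1 2 3))) (exp (\<i> * complex_of_real (perimeter l 1 2 4)))
      (exp (\<i> * complex_of_real (perimeter l 1 3 4))) (exp (\<i> * complex_of_real (perimeter l 2 3 4)))"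
proof -
  interpret symmetric_form "(\<bullet>) :: real^4 \<Rightarrow> real^4 \<Rightarrow> real"
    by (rule symmetric_form_inner)
  have norm: "norm (A i) = 1" if "i \<in> {1..4}" for i
  proof -
    have "A ` {1..4} \<subseteq> sphere 0 1"
      using A by (simp add: spherical_tetrahedron_def)
    then have "A i \<in> sphere 0 1"
      using that by blast
    then show ?thesis by simp
  qed
  have cos_l: "cos (l i j) = A i \<bullet> A j" and sin_l: "sin (l i j) = sqrt (1 - (A i \<bullet> A j)\<^sup>2)"
    if "i \<in> {1..4}" "j \<in> {1..4}" "i \<noteq> j" for i j
    using spherical_law[OF norm norm, of i j] l that
    by (simp_all add: edge_lengths_def spherical_dist_def)
  \<comment> \<open>The factors \<open>1\<close> are the value of \<open>\<kappa>\<close> in \<open>curved_cross_ratio\<close>.\<close>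
  have L: "cos (l i j - l k m) = (A i \<bullet> A j) * (A k \<bullet> A m)
      + 1 * (sqrt (1 - 1 * (A i \<bullet> A j)\<^sup>2) * sqrt (1 - 1 * (A k \<bullet> A m)\<^sup>2))"
    if "{i, j, k, m} \<subseteq> {1..4}" "i \<noteq> j" "k \<noteq> m" for i j k m
    using that by (simp add: cos_diff cos_l sin_l)
  \<comment> \<open>The perimeters give the difference \<open>l 2 3 - l 1 4\<close> where the solid angles give
     \<open>\<alpha> 1 4 - \<alpha> 2 3\<close>.\<close>
  have swap: "cos (l 2 3 - l 1 4) = cos (l 1 4 - l 2 3)"
    by (metis cos_minus minus_diff_eq)
  have dihedral: "dihedral_angles (dihedral_angle (\<bullet>) (\<lambda>p x. x - (1 * (p \<bullet> x)) *\<^sub>R p)) A \<alpha>"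
    using \<alpha> by (simp add: spherical_dihedral_def)
  have inner: "A i \<bullet> A i = 1" if "i \<in> {1..4}" for i
    using norm[OF that] by (simp add: dot_square_norm)
  have indep: "inj_on A {1..4}" "independent (A ` {1..4})"
    using A by (simp_all add: spherical_tetrahedron_def)
  have L': "cos (l 1 4 - l 2 3) = (A 1 \<bullet> A 4) * (A 2 \<bullet> A 3)
      + 1 * (sqrt (1 - 1 * (A 1 \<bullet> A 4)\<^sup>2) * sqrt (1 - 1 * (A 2 \<bullet> A 3)\<^sup>2))"
    "cos (l 1 3 - l 2 4) = (A 1 \<bullet> A 3) * (A 2 \<bullet> A 4)
      + 1 * (sqrt (1 - 1 * (A 1 \<bullet> A 3)\<^sup>2) * sqrt (1 - 1 * (A 2 \<bullet> A 4)\<^sup>2))"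
    "cos (l 1 2 - l 3 4) = (A 1 \<bullet> A 2) * (A 3 \<bullet> A 4)
      + 1 * (sqrt (1 - 1 * (A 1 \<bullet> A 2)\<^sup>2) * sqrt (1 - 1 * (A 3 \<bullet> A 4)\<^sup>2))"
    by (rule L; simp)+
  show ?thesis
    unfolding cross_ratio_exp_i[of "perimeter l 1 2 3"] perimeter_combinations swap L'
    by (rule curved_cross_ratio[OF _ inner _ indep dihedral distinct]) auto
qed

lemma euclidean_tetrahedron_cross_ratio:
  fixes l \<alpha> :: "nat \<Rightarrow> nat \<Rightarrow> real"
  assumes A: "euclidean_tetrahedron A" and l: "edge_lengths dist A l"
    and \<alpha>: "dihedral_angles euclidean_dihedral A \<alpha>"
    and distinct: "solid_angles_distinct \<alpha>"
  shows "solid_angle_cross_ratio \<alpha> =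
    cross_ratio (complex_of_real (perimeter l 1 2 3)) (complex_of_real (perimeter l 1 2 4))
      (complex_of_real (perimeter l 1 3 4)) (complex_of_real (perimeter l 2 3 4))"
proof -
  have l_eq: "l i j = dist (A i) (A j)" if "i \<in> {1..4}" "j \<in> {1..4}" "i \<noteq> j" for i j
    using l that by (simp add: edge_lengths_def)
  have swap: "(l 2 3 - l 1 4)\<^sup>2 = (l 1 4 - l 2 3)\<^sup>2"
    by (rule power2_commute)
  have l_eq': "l 1 4 = dist (A 1) (A 4)" "l 2 3 = dist (A 2) (A 3)" "l 1 3 = dist (A 1) (A 3)"
    "l 2 4 = dist (A 2) (A 4)" "l 1 2 = dist (A 1) (A 2)" "l 3 4 = dist (A 3) (A 4)"
    by (rule l_eq; simp)+
  have indep: "inj_on A {1..4}" "\<not> affine_dependent (A ` {1..4})"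
    using A by (simp_all add: euclidean_tetrahedron_def)
  show ?thesis
    unfolding cross_ratio_of_real perimeter_combinations swap
    unfolding l_eq'
    by (rule euclidean_cross_ratio[OF indep \<alpha>[unfolded euclidean_dihedral_def] distinct])
qed

lemma hyperbolic_tetrahedron_cross_ratio:
  fixes l \<alpha> :: "nat \<Rightarrow> nat \<Rightarrow> real"
  assumes A: "hyperbolic_tetrahedron A" and l: "edge_lengths hyperbolic_dist A l"
    and \<alpha>: "dihedral_angles hyperbolic_dihedral A \<alpha>"
    and distinct: "solid_angles_distinct \<alpha>"
  shows "solid_angle_cross_ratio \<alpha> =
    cross_ratio (complex_of_real (exp (perimeter l 1 2 3))) (complex_of_real (exp (perimeter l 1 2 4)))
      (complex_of_real (exp (perimeter l 1 3 4))) (complex_of_real (exp (perimeter l 2 3 4)))"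
proof -
  interpret symmetric_form lorentz
    by (rule symmetric_form_lorentz)
  have mem: "A i \<in> hyperboloid" if "i \<in> {1..4}" for i
  proof -
    have "A ` {1..4} \<subseteq> hyperboloid"
      using A by (simp add: hyperbolic_tetrahedron_def)
    then show ?thesis
      using that by blast
  qed
  have cosh_l: "cosh (l i j) = - lorentz (A i) (A j)"
    and sinh_l: "sinh (l i j) = sqrt ((lorentz (A i) (A j))\<^sup>2 - 1)"
    if "i \<in> {1..4}" "j \<in> {1..4}" "i \<noteq> j" for i j
    using hyperbolic_law[OF mem mem, of i j] l that by (simp_all add: edge_lengths_def)
  \<comment> \<open>The factors \<open>- 1\<close> are the value of \<open>\<kappa>\<close> in \<open>curved_cross_ratio\<close>.\<close>
  have L: "cosh (l i j - l k m) = lorentz (A i) (A j) * lorentz (A k) (A m)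
      + - 1 * (sqrt (- 1 - - 1 * (lorentz (A i) (A j))\<^sup>2) * sqrt (- 1 - - 1 * (lorentz (A k) (A m))\<^sup>2))"
    if "{i, j, k, m} \<subseteq> {1..4}" "i \<noteq> j" "k \<noteq> m" for i j k m
    using that by (simp add: cosh_diff cosh_l sinh_l)
  have swap: "cosh (l 2 3 - l 1 4) = cosh (l 1 4 - l 2 3)"
    by (metis cosh_minus minus_diff_eq)
  have dihedral: "dihedral_angles (dihedral_angle lorentz (\<lambda>p x. x - (- 1 * lorentz p x) *\<^sub>R p)) A \<alpha>"
    using \<alpha> by (simp add: hyperbolic_dihedral_def)
  have norm: "lorentz (A i) (A i) = - 1" if "i \<in> {1..4}" for i
    using mem[OF that] by (simp add: hyperboloid_def)
  have pos: "lorentz x x > 0" if "i \<in> {1..4}" "lorentz (A i) x = 0" "x \<noteq> 0" for i x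
    using lorentz_tangent_pos[OF mem[OF that(1)] that(2,3)] .
  have indep: "inj_on A {1..4}" "independent (A ` {1..4})"
    using A by (simp_all add: hyperbolic_tetrahedron_def)
  have L': "cosh (l 1 4 - l 2 3) = lorentz (A 1) (A 4) * lorentz (A 2) (A 3)
      + - 1 * (sqrt (- 1 - - 1 * (lorentz (A 1) (A 4))\<^sup>2) * sqrt (- 1 - - 1 * (lorentz (A 2) (A 3))\<^sup>2))"
    "cosh (l 1 3 - l 2 4) = lorentz (A 1) (A 3) * lorentz (A 2) (A 4)
      + - 1 * (sqrt (- 1 - - 1 * (lorentz (A 1) (A 3))\<^sup>2) * sqrt (- 1 - - 1 * (lorentz (A 2) (A 4))\<^sup>2))"
    "cosh (l 1 2 - l 3 4) = lorentz (A 1) (A 2) * lorentz (A 3) (A 4)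
      + - 1 * (sqrt (- 1 - - 1 * (lorentz (A 1) (A 2))\<^sup>2) * sqrt (- 1 - - 1 * (lorentz (A 3) (A 4))\<^sup>2))"
    by (rule L; simp)+
  show ?thesis
    unfolding cross_ratio_exp_real perimeter_combinations swap L'
    by (rule curved_cross_ratio[OF _ norm pos indep dihedral distinct]) auto
qed

theorem corollary1p2:
  fixes l \<alpha> :: "nat \<Rightarrow> nat \<Rightarrow> real"
    and \<Pi>123 \<Pi>124 \<Pi>134 \<Pi>234 \<Omega>123 \<Omega>124 \<Omega>134 \<Omega>234 :: real
  assumes "\<Pi>123 = perimeter l 1 2 3" "\<Pi>124 = perimeter l 1 2 4"
    "\<Pi>134 = perimeter l 1 3 4" "\<Pi>234 = perimeter l 2 3 4"
  assumes "\<Omega>123 = solid_angle \<alpha> 1 2 3 4" "\<Omega>124 = solid_angle \<alpha> 1 2 4 3"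
    "\<Omega>134 = solid_angle \<alpha> 1 3 4 2" "\<Omega>234 = solid_angle \<alpha> 2 3 4 1"
  assumes "distinct [exp (\<i> * complex_of_real \<Omega>123), exp (\<i> * complex_of_real \<Omega>124),
    exp (\<i> * complex_of_real \<Omega>134), exp (\<i> * complex_of_real \<Omega>234)]"
  shows
    "(\<forall>A. spherical_tetrahedron A \<and> edge_lengths spherical_dist A l
        \<and> dihedral_angles spherical_dihedral A \<alpha>
        \<and> distinct [exp (\<i> * complex_of_real \<Pi>123), exp (\<i> * complex_of_real \<Pi>124),
            exp (\<i> * complex_of_real \<Pi>134), exp (\<i> * complex_of_real \<Pi>234)] \<longrightarrow>
        cross_ratio (exp (\<i> * complex_of_real \<Omega>123)) (exp (\<i> * complex_of_real \<Omega>124))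
          (exp (\<i> * complex_of_real \<Omega>134)) (exp (\<i> * complex_of_real \<Omega>234)) =
        cross_ratio (exp (\<i> * complex_of_real \<Pi>123)) (exp (\<i> * complex_of_real \<Pi>124))
          (exp (\<i> * complex_of_real \<Pi>134)) (exp (\<i> * complex_of_real \<Pi>234))) \<and>
     (\<forall>A. euclidean_tetrahedron A \<and> edge_lengths dist A l
        \<and> dihedral_angles euclidean_dihedral A \<alpha>
        \<and> distinct [\<Pi>123, \<Pi>124, \<Pi>134, \<Pi>234] \<longrightarrow>
        cross_ratio (exp (\<i> * complex_of_real \<Omega>123)) (exp (\<i> * complex_of_real \<Omega>124))
          (exp (\<i> * complex_of_real \<Omega>134)) (exp (\<i> * complex_of_real \<Omega>234)) =
        cross_ratio (complex_of_real \<Pi>123) (complex_of_real \<Pi>124)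
          (complex_of_real \<Pi>134) (complex_of_real \<Pi>234)) \<and>
     (\<forall>A. hyperbolic_tetrahedron A \<and> edge_lengths hyperbolic_dist A l
        \<and> dihedral_angles hyperbolic_dihedral A \<alpha>
        \<and> distinct [exp \<Pi>123, exp \<Pi>124, exp \<Pi>134, exp \<Pi>234] \<longrightarrow>
        cross_ratio (exp (\<i> * complex_of_real \<Omega>123)) (exp (\<i> * complex_of_real \<Omega>124))
          (exp (\<i> * complex_of_real \<Omega>134)) (exp (\<i> * complex_of_real \<Omega>234)) =
        cross_ratio (complex_of_real (exp \<Pi>123)) (complex_of_real (exp \<Pi>124))
          (complex_of_real (exp \<Pi>134)) (complex_of_real (exp \<Pi>234)))"
proof -
  note solid_distinct = assms(9)[unfolded assms(5-8)]
  show ?thesis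
    unfolding assms(1-8)
    by (intro conjI allI impI; elim conjE)
      (rule spherical_tetrahedron_cross_ratio euclidean_tetrahedron_cross_ratio
        hyperbolic_tetrahedron_cross_ratio; (assumption | rule solid_distinct))+
qed

end
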